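(* Let $d\ge2$, $\lambda_{\max}\in(0,\infty]$ and $\psi:[0,\lambda_{\max})\to\mathbb{R}$. Suppose $(X_t)_{t\ge1}$ are random vectors in $\mathbb{R}^d$ with constant conditional mean $\mathbb{E}[X_t\mid\mathcal{F}_{t-1}]=\mu$ for all $t\ge1$ which are $(\Sigma_t)$-sub-$\psi$. Let $(\lambda_t)_{t\ge1}$ be a predictable sequence in $[0,\lambda_{\max})$ and let $\alpha\in(0,1)$. Then, with probability at least $1-\alpha$, simultaneously for all $t\geq1$ (with $\sum_{i\le t}\lambda_i>0$), $$\left\|\frac{\sum_{i\leq t}\lambda_iX_i}{\sum_{i\leq t}\lambda_i}-\mu\right\|\leq\frac{\sqrt d\sum_{i\leq t}\psi(\lambda_i)\|\Sigma_i\|+2\sqrt d+\sqrt d\log(1/\alpha)}{\frac23\sum_{i\leq t}\lambda_i}.$$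
   Context: $\mathcal{F}_t=\sigma(X_1,\dots,X_t)$ ($\mathcal{F}_0$ trivial); $(\lambda_t)$ is predictable if $\lambda_t$ is $\mathcal{F}_{t-1}$-measurable for every $t$. $\|\cdot\|$ is the Euclidean norm for vectors and the operator norm for matrices; $\mathbb{S}^{d-1}$ is the Euclidean unit sphere in $\mathbb{R}^d$. $(X_t)$ is $(\Sigma_t)$-sub-$\psi$ if, for every $t$, $\Sigma_t$ is an $\mathcal{F}_t$-measurable random positive semidefinite $d\times d$ matrix and $$\mathbb{E}\big[\exp\{\lambda\langle v,X_t-\mu\rangle-\psi(\lambda)\langle v,\Sigma_tv\rangle\}\mid\mathcal{F}_{t-1}\big]\le 1\quad\text{for all }v\in\mathbb{S}^{d-1},\ \lambda\in[0,\lambda_{\max}).$$ *)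

theory Defs
  imports "HOL-Probability.Probability"
begin

text \<open>The process is indexed from 1, so \<open>X 0\<close> plays no role.\<close>

definition natural_filtration ::
  "'a measure \<Rightarrow> (nat \<Rightarrow> 'a \<Rightarrow> 'b::topological_space) \<Rightarrow> nat \<Rightarrow> 'a measure" where
  "natural_filtration M X t =
     sigma (space M) (\<Union>i\<in>{1..t}. {X i -` A \<inter> space M | A. A \<in> sets borel})"

lemma sets_natural_filtration_0: "sets (natural_filtration M X 0) = {{}, space M}"
  by (simp add: natural_filtration_def sigma_sets_empty_eq)

lemma subalgebra_natural_filtration:
  assumes "\<And>i. i \<ge> 1 \<Longrightarrow> X i \<in> borel_measurable M"
  shows "subalgebra M (natural_filtration M X t)"
proof -
  let ?G = "\<Union>i\<in>{1..t}. {X i -` A \<inter> space M | A. A \<in> sets borel}"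
  have G: "?G \<subseteq> sets M"
    using assms by (auto intro: measurable_sets)
  then have "?G \<subseteq> Pow (space M)"
    using sets.space_closed by blast
  then show ?thesis
    using sets.sigma_sets_subset[OF G]
    by (simp add: subalgebra_def natural_filtration_def space_measure_of sets_measure_of)
qed

definition predictable ::
  "'a measure \<Rightarrow> (nat \<Rightarrow> 'a \<Rightarrow> 'b::topological_space) \<Rightarrow> (nat \<Rightarrow> 'a \<Rightarrow> real) \<Rightarrow> bool" where
  "predictable M X l \<longleftrightarrow>
     (\<forall>t\<ge>1. l t \<in> borel_measurable (natural_filtration M X (t - 1)))"

text \<open>The library's conditional expectation is real-valued; for vectors it is taken in each
  coordinate. It is only meaningful for integrable \<open>X\<close>.\<close>

definition vec_cond_exp ::
  "'a measure \<Rightarrow> 'a measure \<Rightarrow> ('a \<Rightarrow> real^'n) \<Rightarrow> 'a \<Rightarrow> real^'n" where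
  "vec_cond_exp M F X \<omega> = (\<chi> i. real_cond_exp M F (\<lambda>\<omega>. X \<omega> $ i) \<omega>)"

definition pos_semidef :: "real^'n^'n \<Rightarrow> bool" where
  "pos_semidef A \<longleftrightarrow> transpose A = A \<and> (\<forall>v. 0 \<le> v \<bullet> (A *v v))"

text \<open>The exponential is not assumed to be integrable, so its conditional expectation is the
  \<open>[0,\<infinity>]\<close>-valued \<^const>\<open>nn_cond_exp\<close>; \<^const>\<open>real_cond_exp\<close> would turn an infinite value into 0.
  The exceptional null set may depend on \<open>v\<close> and \<open>l\<close>. The function \<open>\<psi>\<close> is only evaluated on
  \<open>[0,lmax)\<close>.\<close>

definition sub_psi ::
  "'a measure \<Rightarrow> ereal \<Rightarrow> (real \<Rightarrow> real) \<Rightarrow> real^'n \<Rightarrow>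
   (nat \<Rightarrow> 'a \<Rightarrow> real^'n^'n) \<Rightarrow> (nat \<Rightarrow> 'a \<Rightarrow> real^'n) \<Rightarrow> bool" where
  "sub_psi M lmax \<psi> \<mu> \<Sigma> X \<longleftrightarrow>
     (\<forall>t\<ge>1.
        \<Sigma> t \<in> borel_measurable (natural_filtration M X t) \<and>
        (\<forall>\<omega>\<in>space M. pos_semidef (\<Sigma> t \<omega>)) \<and>
        (\<forall>v\<in>sphere 0 1. \<forall>l\<ge>0. ereal l < lmax \<longrightarrow>
           (AE \<omega> in M.
              nn_cond_exp M (natural_filtration M X (t - 1))
                (\<lambda>\<omega>. ennreal (exp (l * (v \<bullet> (X t \<omega> - \<mu>)) - \<psi> l * (v \<bullet> (\<Sigma> t \<omega> *v v))))) \<omega> \<le> 1)))"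

end

theory Submission
  imports Defs
begin

text \<open>
  Averaging over the \<open>2^d\<close> unit vectors \<open>v\<close> with all entries \<open>\<plusminus>1/\<surd>d\<close> gives the supermartingale
  \<open>W\<^sub>t = avg\<^sub>v exp(\<langle>v,S\<^sub>t\<rangle> - \<Sum>\<psi>(\<lambda>\<^sub>i)\<langle>v,\<Sigma>\<^sub>iv\<rangle>)\<close> with \<open>S\<^sub>t = \<Sum>\<lambda>\<^sub>i(X\<^sub>i-\<mu>)\<close>, which by Ville's inequality stays
  below \<open>1/\<alpha>\<close> with probability at least \<open>1-\<alpha>\<close>. Since \<open>cosh(\<surd>u)\<close> is convex and the average of
  \<open>\<langle>v,S\<rangle>\<^sup>2\<close> is \<open>\<parallel>S\<parallel>\<^sup>2/d\<close>, the average of \<open>exp\<langle>v,S\<rangle>\<close> is at least \<open>cosh(\<parallel>S\<parallel>/\<surd>d)\<close>, whence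
  \<open>\<parallel>S\<^sub>t\<parallel> \<le> \<surd>d (\<Sum>\<psi>(\<lambda>\<^sub>i)\<parallel>\<Sigma>\<^sub>i\<parallel> + log 2 + log(1/\<alpha>))\<close>.

  Two points need care because \<open>\<psi>\<close> is an arbitrary function. It need not be measurable, and the
  sub-\<open>\<psi>\<close> condition holds for each fixed \<open>\<lambda>\<close> only up to a null set: \<open>\<lambda>\<^sub>t\<close> is therefore replaced by a
  function of \<open>\<lfloor>k\<lambda>\<^sub>t\<rfloor>\<close> that nearly minimises \<open>\<psi>\<close> on each cell of width \<open>1/k\<close>, and \<open>k \<rightarrow> \<infinity>\<close> is taken on
  the limsup of the resulting events. If \<open>\<psi>\<close> is negative somewhere, then Jensen's inequality and
  the constant conditional mean force \<open>\<Sigma>\<^sub>t = 0\<close> almost surely, so \<open>\<psi>\<close> may be replaced by 0.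
\<close>

section \<open>Convexity of \<open>cosh (sqrt u)\<close> in \<open>u\<close>\<close>

lemma sinh_le_mult_cosh:
  fixes x :: real
  assumes "0 \<le> x"
  shows "sinh x \<le> x * cosh x"
proof -
  have "(\<lambda>z. z * cosh z - sinh z) 0 \<le> (\<lambda>z. z * cosh z - sinh z) x"
  proof (rule DERIV_nonneg_imp_nondecreasing[OF assms])
    fix z :: real assume "0 \<le> z" "z \<le> x"
    have "((\<lambda>z. z * cosh z - sinh z) has_real_derivative z * sinh z) (at z)"
      by (auto intro!: derivative_eq_intros)
    then show "\<exists>y. ((\<lambda>z. z * cosh z - sinh z) has_real_derivative y) (at z) \<and> 0 \<le> y"
      using \<open>0 \<le> z\<close> by auto
  qed
  then show ?thesis by simp
qed

text \<open>By the previous lemma the numerator in the quotient rule is nonnegative. Up to the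
  factor 1/2 and the substitution \<open>u = x\<^sup>2\<close>, the quotient is the derivative of
  \<open>cosh (sqrt u)\<close>, so its monotonicity is the convexity of that function.\<close>

lemma sinh_divide_mono:
  fixes x y :: real
  assumes "0 < x" "x \<le> y"
  shows "sinh x / x \<le> sinh y / y"
proof (rule DERIV_nonneg_imp_nondecreasing[OF assms(2)])
  fix z :: real assume "x \<le> z" "z \<le> y"
  with assms have z: "0 < z" by simp
  have "((\<lambda>z. sinh z / z) has_real_derivative (cosh z * z - sinh z) / (z * z)) (at z)"
    using z by (auto intro!: derivative_eq_intros)
  moreover have "0 \<le> (cosh z * z - sinh z) / (z * z)"
    using sinh_le_mult_cosh[of z] z by (simp add: mult.commute)
  ultimately show "\<exists>y. ((\<lambda>z. sinh z / z) has_real_derivative y) (at z) \<and> 0 \<le> y"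
    by blast
qed

text \<open>The left side is the tangent of \<open>cosh (sqrt u)\<close> at
  \<open>u = s\<^sup>2\<close>, evaluated at \<open>u = x\<^sup>2\<close>. Subtracting the slope
  term gives \<open>h\<close>, which decreases up to \<open>s\<close> and increases after it because
  \<open>sinh z / z\<close> is monotone.\<close>

lemma cosh_ge_tangent_square:
  fixes x s :: real
  assumes s: "0 < s"
  shows "cosh s + sinh s / s * ((x\<^sup>2 - s\<^sup>2) / 2) \<le> cosh x"
proof -
  define h where "h z = cosh z - sinh s / s * (z\<^sup>2 / 2)" for z :: real
  have der: "(h has_real_derivative sinh z - sinh s / s * z) (at z)" for z
    unfolding h_def using s by (auto intro!: derivative_eq_intros)
  have "h s \<le> h \<bar>x\<bar>"
  proof (cases "s \<le> \<bar>x\<bar>")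
    case True
    show ?thesis
    proof (rule DERIV_nonneg_imp_nondecreasing[OF True])
      fix z assume "s \<le> z" "z \<le> \<bar>x\<bar>"
      then have "sinh s / s * z \<le> sinh z"
        using sinh_divide_mono[of s z] s by (simp add: pos_le_divide_eq)
      then show "\<exists>y. (h has_real_derivative y) (at z) \<and> 0 \<le> y"
        using der[of z] by (intro exI[of _ "sinh z - sinh s / s * z"]) auto
    qed
  next
    case False
    then have le: "\<bar>x\<bar> \<le> s" by simp
    show ?thesis
    proof (rule DERIV_nonpos_imp_nonincreasing[OF le])
      fix z assume z: "\<bar>x\<bar> \<le> z" "z \<le> s"
      have "sinh z \<le> sinh s / s * z"
      \<comment> \<open>The monotonicity of \<open>sinh z / z\<close> is available only for positive
        arguments; at 0 both sides vanish.\<close>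
      proof (cases "z = 0")
        case False
        with z have "0 < z" by linarith
        then show ?thesis
          using sinh_divide_mono[of z s] z by (simp add: pos_divide_le_eq)
      qed simp
      then show "\<exists>y. (h has_real_derivative y) (at z) \<and> y \<le> 0"
        using der[of z] by (intro exI[of _ "sinh z - sinh s / s * z"]) auto
    qed
  qed
  then show ?thesis
    by (simp add: h_def diff_divide_distrib right_diff_distrib)
qed

section \<open>Averages over the normalised sign vectors\<close>

lemma card_UNIV_set: "CARD('n::finite set) = 2 ^ CARD('n)"
  by (metis Pow_UNIV card_Pow finite)

text \<open>Sign patterns are encoded as subsets of the index type. A sum over all patterns then
  runs over a finite type, toggling membership flips one sign, and taking the complement flips all
  of them.\<close>

definition sign_of :: "'n set \<Rightarrow> 'n \<Rightarrow> real" where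
  "sign_of A i = (if i \<in> A then 1 else -1)"

lemma sum_sign_of_mult:
  fixes i j :: "'n::finite"
  shows "(\<Sum>A\<in>UNIV. sign_of A i * sign_of A j) = (if i = j then 2 ^ CARD('n) else 0)"
proof (cases "i = j")
  case True
  have "(\<Sum>A\<in>(UNIV::'n set set). sign_of A i * sign_of A j) = (\<Sum>A\<in>(UNIV::'n set set). 1)"
    using True by (intro sum.cong) (auto simp: sign_of_def)
  also have "\<dots> = real (card (UNIV :: 'n set set))"
    by simp
  also have "\<dots> = 2 ^ CARD('n)"
    by (simp add: card_UNIV_set)
  finally show ?thesis
    using True by simp
next
  case False
  \<comment> \<open>flipping the sign of entry \<open>i\<close> changes the sign of every term\<close>
  define T where "T A = (if i \<in> A then A - {i} else insert i A)" for A :: "'n set"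
  have "T (T A) = A" for A
    by (auto simp: T_def)
  then have bij: "bij T"
    by (metis bij_betw_byWitness subset_UNIV)
  have "(\<Sum>A\<in>UNIV. sign_of A i * sign_of A j) = (\<Sum>A\<in>UNIV. sign_of (T A) i * sign_of (T A) j)"
    by (rule sum.reindex_bij_betw[OF bij, symmetric])
  also have "\<dots> = (\<Sum>A\<in>UNIV. - (sign_of A i * sign_of A j))"
    using False by (intro sum.cong) (auto simp: sign_of_def T_def)
  finally show ?thesis
    using False by (simp add: sum_negf)
qed

definition sign_vec :: "'n set \<Rightarrow> real^'n::finite" where
  "sign_vec A = (\<chi> i. sign_of A i / sqrt (real CARD('n)))"

lemma norm_sign_vec: "norm (sign_vec A :: real^'n) = 1"
proof -
  have "(\<Sum>i\<in>(UNIV::'n set). (sign_of A i / sqrt (real CARD('n)))\<^sup>2) = (\<Sum>i\<in>(UNIV::'n set). 1 / real CARD('n))"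
    by (intro sum.cong) (auto simp: sign_of_def power_divide)
  then show ?thesis
    by (simp add: norm_eq_sqrt_inner inner_vec_def sign_vec_def power2_eq_square)
qed

text \<open>After expanding the square and exchanging the sums, orthogonality of the signs kills the
  off-diagonal terms; the factor 1/d comes from the normalisation of the vectors.\<close>

lemma sum_inner_sign_vec_square:
  fixes x :: "real^'n"
  shows "(\<Sum>A\<in>UNIV. (sign_vec A \<bullet> x)\<^sup>2) = 2 ^ CARD('n) * ((norm x)\<^sup>2 / real CARD('n))"
proof -
  let ?d = "real CARD('n)"
  have inner: "sign_vec A \<bullet> x = (\<Sum>i\<in>UNIV. sign_of A i * x $ i) / sqrt ?d" for A
    by (simp add: inner_vec_def sign_vec_def sum_divide_distrib)
  have "(sign_vec A \<bullet> x)\<^sup>2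
      = (\<Sum>i\<in>UNIV. \<Sum>j\<in>UNIV. (sign_of A i * sign_of A j) * (x $ i * x $ j)) / ?d" for A
    unfolding inner
    by (simp add: power_divide power2_eq_square[of "sum _ _"] sum_product mult_ac)
  then have "(\<Sum>A\<in>UNIV. (sign_vec A \<bullet> x)\<^sup>2)
      = (\<Sum>A\<in>UNIV. \<Sum>i\<in>UNIV. \<Sum>j\<in>UNIV. (sign_of A i * sign_of A j) * (x $ i * x $ j)) / ?d"
    by (simp add: sum_divide_distrib)
  also have "(\<Sum>A\<in>UNIV. \<Sum>i\<in>UNIV. \<Sum>j\<in>UNIV. (sign_of A i * sign_of A j) * (x $ i * x $ j))
      = (\<Sum>i\<in>UNIV. \<Sum>A\<in>UNIV. \<Sum>j\<in>UNIV. (sign_of A i * sign_of A j) * (x $ i * x $ j))"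
    by (rule sum.swap)
  also have "\<dots> = (\<Sum>i\<in>UNIV. \<Sum>j\<in>UNIV. \<Sum>A\<in>UNIV. (sign_of A i * sign_of A j) * (x $ i * x $ j))"
    by (intro sum.cong refl sum.swap)
  also have "\<dots> = (\<Sum>i\<in>UNIV. \<Sum>j\<in>UNIV. (if i = j then 2 ^ CARD('n) else 0) * (x $ i * x $ j))"
    by (simp only: sum_distrib_right[symmetric] sum_sign_of_mult)
  also have "\<dots> = (\<Sum>i\<in>UNIV. 2 ^ CARD('n) * (x $ i)\<^sup>2)"
    by (intro sum.cong refl) (simp add: if_distrib[of "\<lambda>c. c * _"] power2_eq_square cong: if_cong)
  also have "\<dots> = 2 ^ CARD('n) * (norm x)\<^sup>2"
    unfolding power2_norm_eq_inner by (simp add: sum_distrib_left inner_vec_def power2_eq_square)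
  finally show ?thesis by simp
qed

text \<open>Pairing each pattern with its complement turns \<open>exp\<close> into
  \<open>cosh\<close>. Jensen's inequality for \<open>cosh (sqrt u)\<close> then applies to the
  squares of the inner products, whose average is \<open>s\<^sup>2\<close>, and
  \<open>cosh s\<close> is at least half of \<open>exp s\<close>.\<close>

lemma sum_exp_sign_vec_ge:
  fixes x :: "real^'n"
  shows "2 ^ CARD('n) * (exp (norm x / sqrt (real CARD('n))) / 2) \<le> (\<Sum>A\<in>UNIV. exp (sign_vec A \<bullet> x))"
proof -
  let ?d = "real CARD('n)"
  define s where "s = norm x / sqrt ?d"
  have "bij (uminus :: 'n set \<Rightarrow> 'n set)"
    by (metis bij_betw_byWitness subset_UNIV double_complement)
  then have "(\<Sum>A\<in>UNIV. exp (sign_vec A \<bullet> x)) = (\<Sum>A\<in>UNIV. exp (sign_vec (- A) \<bullet> x))"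
    by (rule sum.reindex_bij_betw[symmetric])
  also have "\<dots> = (\<Sum>A\<in>UNIV. exp (- (sign_vec A \<bullet> x)))"
  proof -
    have "sign_vec (- A) = - (sign_vec A :: real^'n)" for A
      by (simp add: vec_eq_iff sign_vec_def sign_of_def)
    then show ?thesis by simp
  qed
  finally have sym: "(\<Sum>A\<in>UNIV. exp (sign_vec A \<bullet> x)) = (\<Sum>A\<in>UNIV. cosh (sign_vec A \<bullet> x))"
    by (simp add: cosh_def sum.distrib flip: sum_divide_distrib scaleR_sum_right)
  have "2 ^ CARD('n) * cosh s \<le> (\<Sum>A\<in>UNIV. cosh (sign_vec A \<bullet> x))"
  proof (cases "s = 0")
    \<comment> \<open>The tangent bound requires a positive base point, so this case uses
      \<open>cosh \<ge> 1\<close> instead.\<close>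
    case True
    have "(\<Sum>A\<in>(UNIV::'n set set). 1) \<le> (\<Sum>A\<in>UNIV. cosh (sign_vec A \<bullet> x))"
      by (intro sum_mono cosh_real_ge_1)
    with True card_UNIV_set show ?thesis by simp
  next
    case False
    then have s: "0 < s" by (simp add: s_def)
    have "(\<Sum>A\<in>UNIV. cosh s + sinh s / s * (((sign_vec A \<bullet> x)\<^sup>2 - s\<^sup>2) / 2))
        \<le> (\<Sum>A\<in>UNIV. cosh (sign_vec A \<bullet> x))"
      by (intro sum_mono cosh_ge_tangent_square s)
    moreover have "(\<Sum>A\<in>(UNIV::'n set set). cosh s + sinh s / s * (((sign_vec A \<bullet> x)\<^sup>2 - s\<^sup>2) / 2))
        = 2 ^ CARD('n) * cosh s
          + sinh s / s * (((\<Sum>A\<in>UNIV. (sign_vec A \<bullet> x)\<^sup>2) - 2 ^ CARD('n) * s\<^sup>2) / 2)"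
      by (simp add: sum.distrib card_UNIV_set sum_subtractf flip: sum_distrib_left sum_divide_distrib)
    \<comment> \<open>Since \<open>s\<^sup>2\<close> is exactly the average of the squares, the
      linear terms of the tangents sum to zero.\<close>
    moreover have "(\<Sum>A\<in>UNIV. (sign_vec A \<bullet> x)\<^sup>2) = 2 ^ CARD('n) * s\<^sup>2"
      by (simp add: sum_inner_sign_vec_square s_def power_divide)
    ultimately show ?thesis by simp
  qed
  moreover have "exp s / 2 \<le> cosh s"
    by (simp add: cosh_def)
  ultimately have "2 ^ CARD('n) * (exp s / 2) \<le> (\<Sum>A\<in>UNIV. cosh (sign_vec A \<bullet> x))"
    by (meson mult_left_mono order_trans zero_le_numeral zero_le_power)
  with sym show ?thesis by (simp add: s_def)
qed

section \<open>Ville's maximal inequality\<close>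

text \<open>A stopping argument: mass is charged \<open>c\<close> at the first time \<open>W\<close>
  reaches \<open>c\<close>, and the total charge cannot exceed the initial mean. The supermartingale
  property is phrased through integrals over events of \<open>F n\<close>, which makes sense for
  infinite means too.\<close>

lemma (in prob_space) ville_inequality:
  fixes F :: "nat \<Rightarrow> 'a measure" and W :: "nat \<Rightarrow> 'a \<Rightarrow> ennreal"
  assumes sub: "\<And>n. subalgebra M (F n)"
    and mono: "\<And>n. sets (F n) \<subseteq> sets (F (Suc n))"
    and adapted: "\<And>n. W n \<in> borel_measurable (F n)"
    and super: "\<And>n B. B \<in> sets (F n) \<Longrightarrow> (\<integral>\<^sup>+\<omega>\<in>B. W (Suc n) \<omega> \<partial>M) \<le> (\<integral>\<^sup>+\<omega>\<in>B. W n \<omega> \<partial>M)"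
  shows "c * emeasure M {\<omega>\<in>space M. \<exists>n. c \<le> W n \<omega>} \<le> (\<integral>\<^sup>+\<omega>. W 0 \<omega> \<partial>M)"
proof -
  define B where "B n = {\<omega>\<in>space M. \<forall>j\<le>n. W j \<omega> < c}" for n
  have space: "space (F n) = space M" for n
    using sub by (simp add: subalgebra_def)
  have le: "sets (F i) \<subseteq> sets (F j)" if "i \<le> j" for i j
    using mono that by (rule lift_Suc_mono_le)
  have W[measurable]: "W j \<in> borel_measurable M" for j
    using adapted sub by (rule measurable_from_subalg[rotated])
  have BF: "B n \<in> sets (F n)" for n
  proof -
    have "{\<omega>\<in>space (F n). W j \<omega> < c} \<in> sets (F n)" if "j \<le> n" for j
    proof -
      have "{\<omega>\<in>space (F j). W j \<omega> < c} \<in> sets (F j)"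
        using adapted[of j] by measurable
      then show ?thesis
        using le[OF that] space by auto
    qed
    then have "{\<omega>\<in>space (F n). \<forall>j\<in>{..n}. W j \<omega> < c} \<in> sets (F n)"
      by (intro sets.sets_Collect_finite_All) auto
    moreover have "B n = {\<omega>\<in>space (F n). \<forall>j\<in>{..n}. W j \<omega> < c}"
      unfolding B_def space by auto
    ultimately show ?thesis
      by (simp only:)
  qed
  have BM[measurable]: "B n \<in> sets M" for n
    using BF[of n] sub[of n] by (auto simp: subalgebra_def)
  have split: "(\<integral>\<^sup>+\<omega>\<in>B'. W n \<omega> \<partial>M) \<ge> (\<integral>\<^sup>+\<omega>\<in>C. W n \<omega> \<partial>M) + c * emeasure M (B' - C)"
    if [measurable]: "B' \<in> sets M" "C \<in> sets M" and CB: "C \<subseteq> B'"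
      and big: "\<And>\<omega>. \<omega> \<in> B' - C \<Longrightarrow> c \<le> W n \<omega>" for n B' C
  proof -
    have "(\<integral>\<^sup>+\<omega>\<in>C. W n \<omega> \<partial>M) + c * emeasure M (B' - C)
        = (\<integral>\<^sup>+\<omega>. W n \<omega> * indicator C \<omega> + c * indicator (B' - C) \<omega> \<partial>M)"
      by (subst nn_integral_add) (auto simp: nn_integral_cmult_indicator)
    also have "\<dots> \<le> (\<integral>\<^sup>+\<omega>\<in>B'. W n \<omega> \<partial>M)"
      using CB big by (intro nn_integral_mono) (auto split: split_indicator)
    finally show ?thesis .
  qed
  \<comment> \<open>Invariant of the stopped process: what remains on \<open>B n\<close>, plus
    \<open>c\<close> for all mass already stopped. In the step, \<open>super\<close> may be applied
    on \<open>B n\<close> because this event is known at time \<open>n\<close>.\<close>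
  have main: "(\<integral>\<^sup>+\<omega>\<in>B n. W n \<omega> \<partial>M) + c * emeasure M (space M - B n) \<le> (\<integral>\<^sup>+\<omega>. W 0 \<omega> \<partial>M)" for n
  proof (induction n)
    case 0
    have "(\<integral>\<^sup>+\<omega>\<in>space M. W 0 \<omega> \<partial>M) \<ge> (\<integral>\<^sup>+\<omega>\<in>B 0. W 0 \<omega> \<partial>M) + c * emeasure M (space M - B 0)"
      by (rule split) (auto simp: B_def not_less)
    also have "(\<integral>\<^sup>+\<omega>\<in>space M. W 0 \<omega> \<partial>M) = (\<integral>\<^sup>+\<omega>. W 0 \<omega> \<partial>M)"
      by (intro nn_integral_cong) simp
    finally show ?case .
  next
    case (Suc n)
    have sub': "B (Suc n) \<subseteq> B n"
      by (auto simp: B_def)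
    have "emeasure M (space M - B (Suc n)) = emeasure M ((B n - B (Suc n)) \<union> (space M - B n))"
      using sub' by (intro arg_cong[where f="emeasure M"]) (auto simp: B_def)
    also have "\<dots> = emeasure M (B n - B (Suc n)) + emeasure M (space M - B n)"
      by (rule plus_emeasure[symmetric]) auto
    finally have eq: "emeasure M (space M - B (Suc n))
      = emeasure M (B n - B (Suc n)) + emeasure M (space M - B n)" .
    have "(\<integral>\<^sup>+\<omega>\<in>B (Suc n). W (Suc n) \<omega> \<partial>M) + c * emeasure M (B n - B (Suc n))
        \<le> (\<integral>\<^sup>+\<omega>\<in>B n. W (Suc n) \<omega> \<partial>M)"
      by (rule split) (use sub' in \<open>auto simp: B_def not_less le_Suc_eq\<close>)
    also have "\<dots> \<le> (\<integral>\<^sup>+\<omega>\<in>B n. W n \<omega> \<partial>M)"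
      by (rule super[OF BF])
    finally have "(\<integral>\<^sup>+\<omega>\<in>B (Suc n). W (Suc n) \<omega> \<partial>M) + c * emeasure M (B n - B (Suc n))
        + c * emeasure M (space M - B n) \<le> (\<integral>\<^sup>+\<omega>. W 0 \<omega> \<partial>M)"
      using Suc.IH by (meson add_right_mono order_trans)
    then show ?case
      by (simp add: eq distrib_left add.assoc)
  qed
  have "incseq (\<lambda>n. space M - B n)"
    by (auto simp: incseq_def B_def)
  then have "(SUP n. emeasure M (space M - B n)) = emeasure M (\<Union>n. space M - B n)"
    by (intro SUP_emeasure_incseq) auto
  also have "(\<Union>n. space M - B n) = {\<omega>\<in>space M. \<exists>n. c \<le> W n \<omega>}"
    by (auto simp: B_def not_less) (metis leD order_refl)
  finally have sup: "(SUP n. emeasure M (space M - B n)) = emeasure M {\<omega>\<in>space M. \<exists>n. c \<le> W n \<omega>}" .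
  have "c * emeasure M {\<omega>\<in>space M. \<exists>n. c \<le> W n \<omega>} = (SUP n. c * emeasure M (space M - B n))"
    unfolding sup[symmetric] by (rule SUP_mult_left_ennreal)
  also have "\<dots> \<le> (\<integral>\<^sup>+\<omega>. W 0 \<omega> \<partial>M)"
  proof (rule SUP_least)
    fix n
    show "c * emeasure M (space M - B n) \<le> (\<integral>\<^sup>+\<omega>. W 0 \<omega> \<partial>M)"
      by (rule order_trans[OF _ main[of n]]) (rule add_increasing[OF zero_le order_refl])
  qed
  finally show ?thesis .
qed

section \<open>Conditional bounds at a random index\<close>

text \<open>The events \<open>J = j\<close> are countably many and belong to \<open>F\<close>, so
  the integral splits over them, and on each one the bound for the fixed \<open>f j\<close> applies.
  This is how a condition with a null set for each parameter is used at a random parameter.\<close>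

lemma (in sigma_finite_subalgebra) nn_integral_mult_selection_le:
  fixes f :: "nat \<Rightarrow> 'a \<Rightarrow> ennreal"
  assumes [measurable]: "\<And>j. f j \<in> borel_measurable M"
    and le1: "\<And>j. AE \<omega> in M. nn_cond_exp M F (f j) \<omega> \<le> 1"
    and J[measurable]: "J \<in> measurable F (count_space UNIV)"
    and G[measurable]: "G \<in> borel_measurable F"
  shows "(\<integral>\<^sup>+\<omega>. G \<omega> * f (J \<omega>) \<omega> \<partial>M) \<le> (\<integral>\<^sup>+\<omega>. G \<omega> \<partial>M)"
proof -
  have JM[measurable]: "J \<in> measurable M (count_space UNIV)"
    using J by (rule measurable_from_subalg[OF subalg])
  have GM[measurable]: "G \<in> borel_measurable M"
    using G by (rule measurable_from_subalg[OF subalg])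
  have sum: "(\<Sum>j. h j * indicator {J \<omega>} j) = h (J \<omega>)" for h :: "nat \<Rightarrow> ennreal" and \<omega>
    by (subst suminf_finite[of "{J \<omega>}"]) auto
  have "(\<integral>\<^sup>+\<omega>. G \<omega> * f (J \<omega>) \<omega> \<partial>M)
      = (\<integral>\<^sup>+\<omega>. (\<Sum>j. (G \<omega> * f j \<omega>) * indicator {J \<omega>} j) \<partial>M)"
    by (simp add: sum)
  also have "\<dots> = (\<Sum>j. \<integral>\<^sup>+\<omega>. (G \<omega> * f j \<omega>) * indicator {J \<omega>} j \<partial>M)"
    by (rule nn_integral_suminf) (simp add: indicator_def, measurable)
  also have "\<dots> = (\<Sum>j. \<integral>\<^sup>+\<omega>. (G \<omega> * indicator {J \<omega>} j) * f j \<omega> \<partial>M)"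
    by (simp add: mult_ac)
  also have "\<dots> = (\<Sum>j. \<integral>\<^sup>+\<omega>. (G \<omega> * indicator {J \<omega>} j) * nn_cond_exp M F (f j) \<omega> \<partial>M)"
    by (intro arg_cong[where f=suminf] ext nn_cond_exp_intg[symmetric])
       (simp_all add: indicator_def, measurable)
  also have "\<dots> \<le> (\<Sum>j. \<integral>\<^sup>+\<omega>. G \<omega> * indicator {J \<omega>} j \<partial>M)"
  proof (intro suminf_le nn_integral_mono_AE)
    fix j
    show "AE \<omega> in M. G \<omega> * indicator {J \<omega>} j * nn_cond_exp M F (f j) \<omega> \<le> G \<omega> * indicator {J \<omega>} j"
      using le1[of j] by eventually_elim (metis mult.right_neutral mult_left_mono zero_le)
  qed auto
  also have "\<dots> = (\<integral>\<^sup>+\<omega>. (\<Sum>j. G \<omega> * indicator {J \<omega>} j) \<partial>M)"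
    by (rule nn_integral_suminf[symmetric]) (simp add: indicator_def, measurable)
  also have "\<dots> = (\<integral>\<^sup>+\<omega>. G \<omega> \<partial>M)"
    by (simp only: sum)
  finally show ?thesis .
qed

section \<open>Natural filtrations and quadratic forms\<close>

lemma (in finite_measure) sigma_finite_subalgebraI:
  assumes "subalgebra M F"
  shows "sigma_finite_subalgebra M F"
  using assms finite_measure_axioms
  by (intro finite_measure_subalgebra_is_sigma_finite finite_measure_subalgebra.intro
        finite_measure_subalgebra_axioms.intro)

lemma sets_natural_filtration_mono:
  assumes "s \<le> t"
  shows "sets (natural_filtration M X s) \<subseteq> sets (natural_filtration M X t)"
proof -
  have "(\<Union>i\<in>{1..s}. {X i -` A \<inter> space M | A. A \<in> sets borel})
      \<subseteq> (\<Union>i\<in>{1..t}. {X i -` A \<inter> space M | A. A \<in> sets borel})"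
    using assms by (intro UN_mono) auto
  moreover have "(\<Union>i\<in>{1..n}. {X i -` A \<inter> space M | A. A \<in> sets borel}) \<subseteq> Pow (space M)" for n
    by auto
  ultimately show ?thesis
    by (simp add: natural_filtration_def sets_measure_of sigma_sets_mono')
qed

lemma space_natural_filtration [simp]: "space (natural_filtration M X t) = space M"
  by (simp add: natural_filtration_def space_measure_of_conv)

lemma measurable_natural_filtration_mono:
  assumes "f \<in> measurable (natural_filtration M X s) N" "s \<le> t"
  shows "f \<in> measurable (natural_filtration M X t) N"
  using assms sets_natural_filtration_mono[OF assms(2), of M X]
  by (auto simp: measurable_def)

lemma measurable_natural_filtration:
  assumes "1 \<le> i" "i \<le> t"
  shows "X i \<in> borel_measurable (natural_filtration M X t)"
proof (rule measurableI)
  fix A assume "A \<in> sets (borel :: 'b measure)"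
  then have "X i -` A \<inter> space M \<in> (\<Union>i\<in>{1..t}. {X i -` A \<inter> space M | A. A \<in> sets borel})"
    using assms by (intro UN_I[of i]) auto
  moreover have "(\<Union>i\<in>{1..t}. {X i -` A \<inter> space M | A. A \<in> sets borel}) \<subseteq> Pow (space M)"
    by auto
  ultimately show "X i -` A \<inter> space (natural_filtration M X t) \<in> sets (natural_filtration M X t)"
    by (simp add: natural_filtration_def sets_measure_of space_measure_of_conv sigma_sets.Basic)
qed simp

lemma borel_measurable_quadratic_form [measurable (raw)]:
  fixes A :: "'a \<Rightarrow> real^'n^'n"
  assumes "A \<in> borel_measurable M"
  shows "(\<lambda>\<omega>. v \<bullet> (A \<omega> *v v)) \<in> borel_measurable M"
proof -
  have "(\<lambda>B::real^'n^'n. v \<bullet> (B *v v)) \<in> borel_measurable borel"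
    by (intro borel_measurable_continuous_onI)
       (auto simp: inner_vec_def matrix_vector_mult_def intro!: continuous_intros)
  then show ?thesis
    using assms by measurable
qed

lemma quadratic_form_le_onorm:
  fixes A :: "real^'n^'n"
  assumes "norm v = 1"
  shows "v \<bullet> (A *v v) \<le> onorm ((*v) A)"
proof -
  have "v \<bullet> (A *v v) \<le> norm v * norm (A *v v)"
    by (rule norm_cauchy_schwarz)
  also have "\<dots> \<le> onorm ((*v) A)"
    using onorm[OF matrix_vector_mul_bounded_linear, of A v] assms by simp
  finally show ?thesis .
qed

section \<open>The bound for countably valued multipliers\<close>

lemma (in prob_space) norm_sum_le_of_countably_valued:
  fixes X :: "nat \<Rightarrow> 'a \<Rightarrow> real^'n" and \<Sigma> :: "nat \<Rightarrow> 'a \<Rightarrow> real^'n^'n"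
  assumes X: "\<And>t. t \<ge> 1 \<Longrightarrow> X t \<in> borel_measurable M"
    and sub: "sub_psi M lmax \<psi> \<mu> \<Sigma> X"
    and nonneg: "\<And>l. 0 \<le> l \<Longrightarrow> ereal l < lmax \<Longrightarrow> 0 \<le> \<psi> l"
    and d: "\<And>j. 0 \<le> d j" "\<And>j. ereal (d j) < lmax"
    and J: "\<And>t. t \<ge> 1 \<Longrightarrow> J t \<in> measurable (natural_filtration M X (t - 1)) (count_space (UNIV :: nat set))"
    and \<alpha>: "0 < \<alpha>"
  shows "\<exists>E\<in>sets M. prob E \<ge> 1 - \<alpha> \<and> (\<forall>\<omega>\<in>E. \<forall>t.
    norm (\<Sum>i=1..t. d (J i \<omega>) *\<^sub>R (X i \<omega> - \<mu>))
    \<le> sqrt (real CARD('n)) * ((\<Sum>i=1..t. \<psi> (d (J i \<omega>)) * onorm ((*v) (\<Sigma> i \<omega>))) + ln 2 + ln (1 / \<alpha>)))"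
proof -
  define F where "F = natural_filtration M X"
  define g where "g A i j \<omega> = d j * (sign_vec A \<bullet> (X i \<omega> - \<mu>))
    - \<psi> (d j) * (sign_vec A \<bullet> (\<Sigma> i \<omega> *v sign_vec A))" for A i j \<omega>
  define P where "P A t \<omega> = (\<Prod>i=1..t. ennreal (exp (g A i (J i \<omega>) \<omega>)))" for A t \<omega>
  define W where "W t \<omega> = (\<Sum>A\<in>UNIV. P A t \<omega>)" for t \<omega>
  \<comment> \<open>\<open>W\<close> is a sum and not an average, so it starts at
    \<open>2 ^ CARD('n)\<close>; the threshold carries the same factor, and Ville's inequality gives
    failure probability at most \<alpha>.\<close>
  define c :: real where "c = 2 ^ CARD('n) / \<alpha>"
  have c: "0 < c"
    using \<alpha> by (simp add: c_def)
  have subalg: "subalgebra M (F t)" for t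
    unfolding F_def by (rule subalgebra_natural_filtration[OF X])
  have sigfin: "sigma_finite_subalgebra M (F t)" for t
    by (rule sigma_finite_subalgebraI[OF subalg])
  have XF: "X i \<in> borel_measurable (F t)" if "1 \<le> i" "i \<le> t" for i t
    unfolding F_def using that by (rule measurable_natural_filtration)
  have SF: "\<Sigma> i \<in> borel_measurable (F t)" if "1 \<le> i" "i \<le> t" for i t
    using sub that unfolding sub_psi_def F_def
    by (blast intro: measurable_natural_filtration_mono)
  have JF: "J i \<in> measurable (F t) (count_space UNIV)" if "1 \<le> i" "i \<le> t" for i t
    unfolding F_def
    by (rule measurable_natural_filtration_mono[OF J[OF that(1)]]) (use that in simp)
  have gF: "(\<lambda>\<omega>. g A i (J i \<omega>) \<omega>) \<in> borel_measurable (F t)" if "1 \<le> i" "i \<le> t" for A i t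
  proof -
    note [measurable] = XF[OF that] SF[OF that] JF[OF that]
    show ?thesis unfolding g_def by measurable
  qed
  have PF[measurable]: "P A t \<in> borel_measurable (F t)" for A t
  proof -
    have "(\<lambda>\<omega>. ennreal (exp (g A i (J i \<omega>) \<omega>))) \<in> borel_measurable (F t)" if "i \<in> {1..t}" for i
    proof -
      have [measurable]: "(\<lambda>\<omega>. g A i (J i \<omega>) \<omega>) \<in> borel_measurable (F t)"
        using that by (intro gF) auto
      show ?thesis by measurable
    qed
    then show ?thesis
      unfolding P_def by (rule borel_measurable_prod_ennreal)
  qed
  have WF: "W t \<in> borel_measurable (F t)" for t
    unfolding W_def by (intro borel_measurable_sum PF)
  have gM: "(\<lambda>\<omega>. ennreal (exp (g A i j \<omega>))) \<in> borel_measurable M" if "1 \<le> i" for A i j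
  proof -
    have [measurable]: "X i \<in> borel_measurable M" "\<Sigma> i \<in> borel_measurable M"
      using X[OF that] measurable_from_subalg[OF subalg SF[OF that order_refl]] by auto
    show ?thesis unfolding g_def by measurable
  qed
  have PM[measurable]: "P A t \<in> borel_measurable M" for A t
    by (rule measurable_from_subalg[OF subalg PF])
  have WM[measurable]: "W t \<in> borel_measurable M" for t
    by (rule measurable_from_subalg[OF subalg WF])
  have stepP: "(\<integral>\<^sup>+\<omega>\<in>B. P A (Suc n) \<omega> \<partial>M) \<le> (\<integral>\<^sup>+\<omega>\<in>B. P A n \<omega> \<partial>M)"
    if B[measurable]: "B \<in> sets (F n)" for n A B
  proof -
    interpret S: sigma_finite_subalgebra M "F n"
      by (rule sigfin)
    have "(\<integral>\<^sup>+\<omega>\<in>B. P A (Suc n) \<omega> \<partial>M)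
      = (\<integral>\<^sup>+\<omega>. (P A n \<omega> * indicator B \<omega>) * ennreal (exp (g A (Suc n) (J (Suc n) \<omega>) \<omega>)) \<partial>M)"
      by (simp add: P_def mult_ac)
    also have "\<dots> \<le> (\<integral>\<^sup>+\<omega>. P A n \<omega> * indicator B \<omega> \<partial>M)"
    \<comment> \<open>Here \<open>G\<close> is the past product \<open>P A n\<close> restricted to
      \<open>B\<close>, and \<open>f\<close> lists the exponentials for the countably many
      multipliers \<open>d j\<close>.\<close>
    proof (rule S.nn_integral_mult_selection_le)
      fix j
      have "sign_vec A \<in> sphere (0 :: real^'n) 1"
        by (simp add: norm_sign_vec)
      moreover have "1 \<le> Suc n"
        by simp
      ultimately have "AE \<omega> in M. nn_cond_exp M (natural_filtration M X (Suc n - 1))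
          (\<lambda>\<omega>. ennreal (exp (g A (Suc n) j \<omega>))) \<omega> \<le> 1"
        using sub d[of j] unfolding sub_psi_def g_def by blast
      then show "AE \<omega> in M. nn_cond_exp M (F n) (\<lambda>\<omega>. ennreal (exp (g A (Suc n) j \<omega>))) \<omega> \<le> 1"
        by (simp add: F_def)
    next
      show "(\<lambda>\<omega>. ennreal (exp (g A (Suc n) j \<omega>))) \<in> borel_measurable M" for j
        by (rule gM) simp
    next
      show "J (Suc n) \<in> measurable (F n) (count_space UNIV)"
        using J[of "Suc n"] by (simp add: F_def)
    qed measurable
    finally show ?thesis .
  qed
  have "ennreal c * emeasure M {\<omega>\<in>space M. \<exists>n. ennreal c \<le> W n \<omega>} \<le> (\<integral>\<^sup>+\<omega>. W 0 \<omega> \<partial>M)"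
  proof (rule ville_inequality[OF subalg _ WF])
    show "sets (F n) \<subseteq> sets (F (Suc n))" for n
      unfolding F_def by (rule sets_natural_filtration_mono) simp
  next
    fix n B assume B: "B \<in> sets (F n)"
    then have [measurable]: "B \<in> sets M"
      using subalg[of n] by (auto simp: subalgebra_def)
    have "(\<integral>\<^sup>+\<omega>\<in>B. W (Suc n) \<omega> \<partial>M) = (\<Sum>A\<in>UNIV. \<integral>\<^sup>+\<omega>\<in>B. P A (Suc n) \<omega> \<partial>M)"
      unfolding W_def sum_distrib_right by (rule nn_integral_sum) measurable
    also have "\<dots> \<le> (\<Sum>A\<in>UNIV. \<integral>\<^sup>+\<omega>\<in>B. P A n \<omega> \<partial>M)"
      by (intro sum_mono stepP B)
    also have "\<dots> = (\<integral>\<^sup>+\<omega>\<in>B. W n \<omega> \<partial>M)"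
      unfolding W_def sum_distrib_right by (rule nn_integral_sum[symmetric]) measurable
    finally show "(\<integral>\<^sup>+\<omega>\<in>B. W (Suc n) \<omega> \<partial>M) \<le> (\<integral>\<^sup>+\<omega>\<in>B. W n \<omega> \<partial>M)" .
  qed
  also have "(\<integral>\<^sup>+\<omega>. W 0 \<omega> \<partial>M) = ennreal (2 ^ CARD('n))"
    by (simp add: W_def P_def emeasure_space_1 card_UNIV_set ennreal_power[symmetric])
  finally have "ennreal (c * prob {\<omega>\<in>space M. \<exists>n. ennreal c \<le> W n \<omega>}) \<le> ennreal (2 ^ CARD('n))"
    using c by (simp add: emeasure_eq_measure ennreal_mult)
  then have bad: "prob {\<omega>\<in>space M. \<exists>n. ennreal c \<le> W n \<omega>} \<le> \<alpha>"
    using \<alpha> by (simp add: c_def field_simps)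
  define E where "E = space M - {\<omega>\<in>space M. \<exists>n. ennreal c \<le> W n \<omega>}"
  have badM: "{\<omega>\<in>space M. \<exists>n. ennreal c \<le> W n \<omega>} \<in> sets M"
    by measurable
  have "E \<in> sets M"
    unfolding E_def using badM by auto
  moreover have "prob E \<ge> 1 - \<alpha>"
    using bad badM unfolding E_def by (simp add: prob_compl)
  moreover have "norm (\<Sum>i=1..t. d (J i \<omega>) *\<^sub>R (X i \<omega> - \<mu>))
      \<le> sqrt (real CARD('n)) * ((\<Sum>i=1..t. \<psi> (d (J i \<omega>)) * onorm ((*v) (\<Sigma> i \<omega>))) + ln 2 + ln (1 / \<alpha>))"
    if \<omega>: "\<omega> \<in> E" for \<omega> t
  proof -
    define S where "S = (\<Sum>i=1..t. d (J i \<omega>) *\<^sub>R (X i \<omega> - \<mu>))"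
    define V where "V = (\<Sum>i=1..t. \<psi> (d (J i \<omega>)) * onorm ((*v) (\<Sigma> i \<omega>)))"
    \<comment> \<open>Since the sign vectors are unit vectors and \<psi> is nonnegative at every
      \<open>d j\<close>, each quadratic form may be replaced by the operator norm, which no longer
      depends on \<open>A\<close>.\<close>
    have lower: "exp (sign_vec A \<bullet> S) * exp (- V) \<le> exp (\<Sum>i=1..t. g A i (J i \<omega>) \<omega>)" for A
    proof -
      have "sign_vec A \<bullet> S - V = (\<Sum>i=1..t. d (J i \<omega>) * (sign_vec A \<bullet> (X i \<omega> - \<mu>))
            - \<psi> (d (J i \<omega>)) * onorm ((*v) (\<Sigma> i \<omega>)))"
        by (simp add: S_def V_def inner_sum_right sum_subtractf)
      also have "\<dots> \<le> (\<Sum>i=1..t. g A i (J i \<omega>) \<omega>)"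
        unfolding g_def
        by (intro sum_mono diff_left_mono mult_left_mono quadratic_form_le_onorm norm_sign_vec nonneg d)
      finally show ?thesis
        by (simp flip: exp_add)
    qed
    have "W t \<omega> = ennreal (\<Sum>A\<in>UNIV. exp (\<Sum>i=1..t. g A i (J i \<omega>) \<omega>))"
      by (simp add: W_def P_def prod_ennreal exp_sum sum_nonneg prod_nonneg)
    moreover have "W t \<omega> < ennreal c"
      using \<omega> by (auto simp: E_def not_le)
    ultimately have "(\<Sum>A\<in>UNIV. exp (\<Sum>i=1..t. g A i (J i \<omega>) \<omega>)) < c"
      using c by (simp add: ennreal_less_iff sum_nonneg)
    then have "(\<Sum>A\<in>UNIV. exp (sign_vec A \<bullet> S) * exp (- V)) < c"
      using sum_mono[of UNIV, OF lower] by (rule le_less_trans[rotated])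
    moreover have "2 ^ CARD('n) * (exp (norm S / sqrt (real CARD('n))) / 2) * exp (- V)
        \<le> (\<Sum>A\<in>UNIV. exp (sign_vec A \<bullet> S)) * exp (- V)"
      by (intro mult_right_mono sum_exp_sign_vec_ge) simp
    ultimately have "2 ^ CARD('n) * (exp (norm S / sqrt (real CARD('n))) / 2) * exp (- V) < 2 ^ CARD('n) / \<alpha>"
      unfolding c_def sum_distrib_right[symmetric] by (rule le_less_trans[rotated])
    then have "2 ^ CARD('n) * (exp (norm S / sqrt (real CARD('n))) / 2 * exp (- V)) < 2 ^ CARD('n) * (1 / \<alpha>)"
      by (simp add: mult_ac)
    then have "exp (norm S / sqrt (real CARD('n))) / 2 * exp (- V) < 1 / \<alpha>"
      by (subst (asm) mult_less_cancel_left_pos) auto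
    \<comment> \<open>The factor 1/2 lost in passing from \<open>cosh\<close> to \<open>exp\<close>
      becomes the summand \<open>ln 2\<close>.\<close>
    then have "exp (norm S / sqrt (real CARD('n))) < exp (V + ln 2 + ln (1 / \<alpha>))"
      using \<alpha> by (simp add: exp_add exp_minus field_simps)
    then have "norm S / sqrt (real CARD('n)) < V + ln 2 + ln (1 / \<alpha>)"
      by (simp only: exp_less_cancel_iff)
    then have "norm S \<le> sqrt (real CARD('n)) * (V + ln 2 + ln (1 / \<alpha>))"
      by (simp add: pos_divide_less_eq mult.commute)
    then show ?thesis
      by (simp only: S_def V_def)
  qed
  ultimately show ?thesis by blast
qed

section \<open>From countably valued to arbitrary predictable multipliers\<close>

text \<open>Each tail union contains some \<open>E k\<close>, and the tail unions decrease to the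
  limsup, so continuity from above applies.\<close>

lemma (in finite_measure) measure_limsup_ge:
  fixes E :: "nat \<Rightarrow> 'a set"
  assumes E[measurable]: "\<And>k. E k \<in> sets M" and ge: "\<And>k. a \<le> measure M (E k)"
  shows "a \<le> measure M (\<Inter>n. \<Union>k\<in>{n..}. E k)"
proof (rule LIMSEQ_le_const)
  show "(\<lambda>n. measure M (\<Union>k\<in>{n..}. E k)) \<longlonglongrightarrow> measure M (\<Inter>n. \<Union>k\<in>{n..}. E k)"
    by (rule finite_Lim_measure_decseq) (auto simp: decseq_def intro: order_trans)
  have "a \<le> measure M (\<Union>k\<in>{n..}. E k)" for n
    using ge[of n] finite_measure_mono[of "E n" "\<Union>k\<in>{n..}. E k"] by fastforce
  then show "\<exists>N. \<forall>n\<ge>N. a \<le> measure M (\<Union>k\<in>{n..}. E k)"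
    by blast
qed

text \<open>Each cell of width \<epsilon> gets one representative. Nonnegativity of \<psi> makes its
  infimum on the cell finite; the infimum need not be attained, hence the slack \<epsilon>.\<close>

lemma ex_floor_selection:
  fixes \<psi> :: "real \<Rightarrow> real"
  assumes "0 < lmax" and nonneg: "\<And>l. 0 \<le> l \<Longrightarrow> ereal l < lmax \<Longrightarrow> 0 \<le> \<psi> l" and \<epsilon>: "0 < \<epsilon>"
  shows "\<exists>d::nat \<Rightarrow> real. (\<forall>j. 0 \<le> d j \<and> ereal (d j) < lmax) \<and>
    (\<forall>l. 0 \<le> l \<longrightarrow> ereal l < lmax \<longrightarrow>
      \<bar>d (nat \<lfloor>l / \<epsilon>\<rfloor>) - l\<bar> \<le> \<epsilon> \<and> \<psi> (d (nat \<lfloor>l / \<epsilon>\<rfloor>)) \<le> \<psi> l + \<epsilon>)"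
proof -
  define C where "C j = {l. 0 \<le> l \<and> ereal l < lmax \<and> nat \<lfloor>l / \<epsilon>\<rfloor> = j}" for j
  have "\<exists>x. 0 \<le> x \<and> ereal x < lmax \<and> (C j \<noteq> {} \<longrightarrow> x \<in> C j \<and> (\<forall>l\<in>C j. \<psi> x \<le> \<psi> l + \<epsilon>))" for j
  proof (cases "C j = {}")
    \<comment> \<open>Default value for an empty cell: 0 is admissible because \<open>lmax\<close>
      is positive.\<close>
    case True
    then show ?thesis
      using assms(1) by (intro exI[of _ 0]) (simp add: zero_ereal_def)
  next
    case False
    have bdd: "bdd_below (\<psi> ` C j)"
      using nonneg by (intro bdd_belowI[of _ 0]) (auto simp: C_def)
    have "\<psi> ` C j \<noteq> {}" "Inf (\<psi> ` C j) < Inf (\<psi> ` C j) + \<epsilon>"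
      using False \<epsilon> by simp_all
    from cInf_lessD[OF this] obtain x where x: "x \<in> C j" "\<psi> x < Inf (\<psi> ` C j) + \<epsilon>"
      by blast
    moreover have "\<psi> x \<le> \<psi> l + \<epsilon>" if "l \<in> C j" for l
      using cInf_lower[OF imageI[OF that] bdd] x(2) by simp
    ultimately show ?thesis
      by (intro exI[of _ x]) (auto simp: C_def)
  qed
  then obtain d where d: "\<And>j. 0 \<le> d j \<and> ereal (d j) < lmax"
    and dC: "\<And>j. C j \<noteq> {} \<Longrightarrow> d j \<in> C j \<and> (\<forall>l\<in>C j. \<psi> (d j) \<le> \<psi> l + \<epsilon>)"
    by metis
  have "\<bar>d (nat \<lfloor>l / \<epsilon>\<rfloor>) - l\<bar> \<le> \<epsilon> \<and> \<psi> (d (nat \<lfloor>l / \<epsilon>\<rfloor>)) \<le> \<psi> l + \<epsilon>"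
    if l: "0 \<le> l" "ereal l < lmax" for l
  proof -
    define j where "j = nat \<lfloor>l / \<epsilon>\<rfloor>"
    have lC: "l \<in> C j"
      using l by (simp add: C_def j_def)
    then have dj: "d j \<in> C j" "\<psi> (d j) \<le> \<psi> l + \<epsilon>"
      using dC[of j] by auto
    have cell: "real j * \<epsilon> \<le> x \<and> x \<le> real j * \<epsilon> + \<epsilon>" if "x \<in> C j" for x
    proof -
      have "0 \<le> x / \<epsilon>"
        using that \<epsilon> by (simp add: C_def)
      then have "real j = of_int \<lfloor>x / \<epsilon>\<rfloor>"
        using that by (auto simp: C_def)
      then have "real j \<le> x / \<epsilon>" "x / \<epsilon> \<le> real j + 1"
        by linarith+
      then show ?thesis
        using \<epsilon> by (simp add: pos_le_divide_eq pos_divide_le_eq distrib_right)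
    qed
    show ?thesis
      using cell[OF lC] cell[OF dj(1)] dj(2) by (simp add: j_def abs_le_iff)
  qed
  with d show ?thesis by blast
qed

lemma (in prob_space) norm_sum_le_of_predictable:
  fixes X :: "nat \<Rightarrow> 'a \<Rightarrow> real^'n" and \<Sigma> :: "nat \<Rightarrow> 'a \<Rightarrow> real^'n^'n"
  assumes X: "\<And>t. t \<ge> 1 \<Longrightarrow> X t \<in> borel_measurable M"
    and sub: "sub_psi M lmax \<psi> \<mu> \<Sigma> X"
    and lmax: "0 < lmax"
    and nonneg: "\<And>l. 0 \<le> l \<Longrightarrow> ereal l < lmax \<Longrightarrow> 0 \<le> \<psi> l"
    and pred: "predictable M X lam"
    and lam: "\<And>t \<omega>. t \<ge> 1 \<Longrightarrow> \<omega> \<in> space M \<Longrightarrow> 0 \<le> lam t \<omega> \<and> ereal (lam t \<omega>) < lmax"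
    and \<alpha>: "0 < \<alpha>"
  shows "\<exists>E\<in>sets M. prob E \<ge> 1 - \<alpha> \<and> (\<forall>\<omega>\<in>E. \<forall>t.
    norm (\<Sum>i=1..t. lam i \<omega> *\<^sub>R (X i \<omega> - \<mu>))
    \<le> sqrt (real CARD('n)) * ((\<Sum>i=1..t. \<psi> (lam i \<omega>) * onorm ((*v) (\<Sigma> i \<omega>))) + ln 2 + ln (1 / \<alpha>)))"
proof -
  let ?\<epsilon> = "\<lambda>k. inverse (real (Suc k))"
  have "\<forall>k. \<exists>d::nat \<Rightarrow> real. (\<forall>j. 0 \<le> d j \<and> ereal (d j) < lmax) \<and>
    (\<forall>l. 0 \<le> l \<longrightarrow> ereal l < lmax \<longrightarrow>
      \<bar>d (nat \<lfloor>l / ?\<epsilon> k\<rfloor>) - l\<bar> \<le> ?\<epsilon> k \<and> \<psi> (d (nat \<lfloor>l / ?\<epsilon> k\<rfloor>)) \<le> \<psi> l + ?\<epsilon> k)"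
    by (intro allI ex_floor_selection lmax nonneg) auto
  then obtain d :: "nat \<Rightarrow> nat \<Rightarrow> real"
    where d: "\<And>k j. 0 \<le> d k j" "\<And>k j. ereal (d k j) < lmax"
      and approx: "\<And>k l. 0 \<le> l \<Longrightarrow> ereal l < lmax \<Longrightarrow> \<bar>d k (nat \<lfloor>l / ?\<epsilon> k\<rfloor>) - l\<bar> \<le> ?\<epsilon> k"
        "\<And>k l. 0 \<le> l \<Longrightarrow> ereal l < lmax \<Longrightarrow> \<psi> (d k (nat \<lfloor>l / ?\<epsilon> k\<rfloor>)) \<le> \<psi> l + ?\<epsilon> k"
    by metis
  \<comment> \<open>The index depends on \<open>lam\<close> through a floor only, so it is
    predictable whatever \<psi> is.\<close>
  define J where "J k t \<omega> = nat \<lfloor>lam t \<omega> / ?\<epsilon> k\<rfloor>" for k t \<omega>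
  have J_meas: "J k t \<in> measurable (natural_filtration M X (t - 1)) (count_space UNIV)" if "t \<ge> 1" for k t
  proof -
    have [measurable]: "lam t \<in> borel_measurable (natural_filtration M X (t - 1))"
      using pred that by (simp add: predictable_def)
    show ?thesis unfolding J_def by measurable
  qed
  define Q where "Q k \<omega> \<longleftrightarrow> (\<forall>t. norm (\<Sum>i=1..t. d k (J k i \<omega>) *\<^sub>R (X i \<omega> - \<mu>))
    \<le> sqrt (real CARD('n)) * ((\<Sum>i=1..t. \<psi> (d k (J k i \<omega>)) * onorm ((*v) (\<Sigma> i \<omega>))) + ln 2 + ln (1 / \<alpha>)))"
    for k \<omega>
  have "\<exists>E\<in>sets M. prob E \<ge> 1 - \<alpha> \<and> (\<forall>\<omega>\<in>E. Q k \<omega>)" for k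
    unfolding Q_def by (rule norm_sum_le_of_countably_valued[OF X sub nonneg d J_meas \<alpha>])
  then obtain E where E: "\<And>k. E k \<in> sets M" "\<And>k. prob (E k) \<ge> 1 - \<alpha>"
    and Q: "\<And>k \<omega>. \<omega> \<in> E k \<Longrightarrow> Q k \<omega>"
    by metis
  \<comment> \<open>The good events for different \<open>k\<close> are unrelated, so their
    intersection could be small. Their limsup keeps the probability and still supplies infinitely
    many \<open>k\<close>.\<close>
  let ?L = "\<Inter>n. \<Union>k\<in>{n..}. E k"
  have "?L \<in> sets M"
    using E(1) by measurable
  moreover have "prob ?L \<ge> 1 - \<alpha>"
    using E by (rule measure_limsup_ge)
  moreover have "norm (\<Sum>i=1..t. lam i \<omega> *\<^sub>R (X i \<omega> - \<mu>))
    \<le> sqrt (real CARD('n)) * ((\<Sum>i=1..t. \<psi> (lam i \<omega>) * onorm ((*v) (\<Sigma> i \<omega>))) + ln 2 + ln (1 / \<alpha>))"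
    (is "?l \<le> ?r") if \<omega>: "\<omega> \<in> ?L" for \<omega> t
  proof (rule ccontr)
    \<comment> \<open>For a fixed \<open>t\<close>, a strict violation in the limit would persist
      for all large \<open>k\<close>, against the bound at some large \<open>k\<close> with
      \<open>\<omega> \<in> E k\<close>.\<close>
    assume "\<not> ?l \<le> ?r"
    then have less: "?r < ?l" by simp
    have "\<omega> \<in> space M"
      using \<omega> sets.sets_into_space[OF E(1)] by blast
    then have l: "0 \<le> lam i \<omega>" "ereal (lam i \<omega>) < lmax" if "i \<in> {1..t}" for i
      using lam[of i \<omega>] that by auto
    have \<epsilon>0: "?\<epsilon> \<longlonglongrightarrow> 0"
      by (rule LIMSEQ_inverse_real_of_nat)
    have "(\<lambda>k. d k (J k i \<omega>)) \<longlonglongrightarrow> lam i \<omega>" if "i \<in> {1..t}" for i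
    proof (rule LIM_zero_cancel, rule Lim_null_comparison[OF _ \<epsilon>0])
      show "\<forall>\<^sub>F k in sequentially. norm (d k (J k i \<omega>) - lam i \<omega>) \<le> ?\<epsilon> k"
        using approx(1)[OF l[OF that]] by (auto simp: J_def)
    qed
    then have lim_l: "(\<lambda>k. norm (\<Sum>i=1..t. d k (J k i \<omega>) *\<^sub>R (X i \<omega> - \<mu>))) \<longlonglongrightarrow> ?l"
      by (intro tendsto_intros) auto
    \<comment> \<open>The values of \<psi> at the representatives need not converge, so they are
      first replaced by their upper bounds, which do.\<close>
    let ?r' = "\<lambda>k. sqrt (real CARD('n)) *
        ((\<Sum>i=1..t. (\<psi> (lam i \<omega>) + ?\<epsilon> k) * onorm ((*v) (\<Sigma> i \<omega>))) + ln 2 + ln (1 / \<alpha>))"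
    have "?r' \<longlonglongrightarrow> sqrt (real CARD('n)) *
        ((\<Sum>i=1..t. (\<psi> (lam i \<omega>) + 0) * onorm ((*v) (\<Sigma> i \<omega>))) + ln 2 + ln (1 / \<alpha>))"
      by (intro tendsto_intros \<epsilon>0)
    then have lim_r: "?r' \<longlonglongrightarrow> ?r" by simp
    have "\<forall>\<^sub>F k in sequentially. 0 < norm (\<Sum>i=1..t. d k (J k i \<omega>) *\<^sub>R (X i \<omega> - \<mu>)) - ?r' k"
      using order_tendstoD(1)[OF tendsto_diff[OF lim_l lim_r], of 0] less by simp
    then obtain n where n: "\<And>k. k \<ge> n \<Longrightarrow> 0 < norm (\<Sum>i=1..t. d k (J k i \<omega>) *\<^sub>R (X i \<omega> - \<mu>)) - ?r' k"
      unfolding eventually_sequentially by blast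
    obtain k where k: "k \<ge> n" "\<omega> \<in> E k"
      using \<omega> by auto
    have "norm (\<Sum>i=1..t. d k (J k i \<omega>) *\<^sub>R (X i \<omega> - \<mu>)) \<le> ?r' k"
    proof (rule order_trans[OF Q[OF k(2), unfolded Q_def, rule_format]])
      have "(\<Sum>i=1..t. \<psi> (d k (J k i \<omega>)) * onorm ((*v) (\<Sigma> i \<omega>)))
          \<le> (\<Sum>i=1..t. (\<psi> (lam i \<omega>) + ?\<epsilon> k) * onorm ((*v) (\<Sigma> i \<omega>)))"
        using approx(2)[OF l]
        by (intro sum_mono mult_right_mono onorm_pos_le matrix_vector_mul_bounded_linear) (auto simp: J_def)
      then show "sqrt (real CARD('n)) * ((\<Sum>i=1..t. \<psi> (d k (J k i \<omega>)) * onorm ((*v) (\<Sigma> i \<omega>))) + ln 2 + ln (1 / \<alpha>)) \<le> ?r' k"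
        by (intro mult_left_mono add_right_mono) auto
    qed
    with n[OF k(1)] show False by simp
  qed
  ultimately show ?thesis by blast
qed

section \<open>Degeneracy when \<psi> takes a negative value\<close>

text \<open>The exponent \<open>z\<close> is a centred variable plus a nonnegative one, while
  \<open>exp z\<close> has mean at most 1. As \<open>exp z \<ge> 1 + z\<close>, the nonnegative part
  must vanish almost surely.\<close>

lemma (in prob_space) AE_quadratic_form_eq_0:
  fixes X :: "nat \<Rightarrow> 'a \<Rightarrow> real^'n" and \<Sigma> :: "nat \<Rightarrow> 'a \<Rightarrow> real^'n^'n"
  assumes X: "\<And>t. t \<ge> 1 \<Longrightarrow> X t \<in> borel_measurable M"
    and int: "integrable M (X t)"
    and mean: "AE \<omega> in M. vec_cond_exp M (natural_filtration M X (t - 1)) (X t) \<omega> = \<mu>"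
    and sub: "sub_psi M lmax \<psi> \<mu> \<Sigma> X"
    and l: "0 \<le> l" "ereal l < lmax" "\<psi> l < 0"
    and t: "t \<ge> 1" and v: "norm v = 1"
  shows "AE \<omega> in M. v \<bullet> (\<Sigma> t \<omega> *v v) = 0"
proof -
  let ?F = "natural_filtration M X (t - 1)"
  have subalg: "subalgebra M (natural_filtration M X s)" for s
    by (rule subalgebra_natural_filtration[OF X])
  interpret S: sigma_finite_subalgebra M ?F
    by (rule sigma_finite_subalgebraI[OF subalg])
  have [measurable]: "X t \<in> borel_measurable M"
    using X t by simp
  have "\<Sigma> t \<in> borel_measurable (natural_filtration M X t)"
    using sub t by (simp add: sub_psi_def)
  then have [measurable]: "\<Sigma> t \<in> borel_measurable M"
    by (rule measurable_from_subalg[OF subalg])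
  have q0: "0 \<le> v \<bullet> (\<Sigma> t \<omega> *v v)" if "\<omega> \<in> space M" for \<omega>
    using sub t that by (simp add: sub_psi_def pos_semidef_def)
  define z where "z \<omega> = l * (v \<bullet> (X t \<omega> - \<mu>)) - \<psi> l * (v \<bullet> (\<Sigma> t \<omega> *v v))" for \<omega>
  have zM[measurable]: "z \<in> borel_measurable M"
    unfolding z_def by measurable
  have coord: "(\<integral>\<omega>. X t \<omega> $ i \<partial>M) = \<mu> $ i" for i
  proof -
    have int_i: "integrable M (\<lambda>\<omega>. X t \<omega> $ i)"
      using integrable_bounded_linear[OF bounded_linear_vec_nth int] .
    have "(\<integral>\<omega>. X t \<omega> $ i \<partial>M) = (\<integral>\<omega>. real_cond_exp M ?F (\<lambda>\<omega>. X t \<omega> $ i) \<omega> \<partial>M)"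
      using S.real_cond_exp_int(2)[OF int_i] by simp
    also have "\<dots> = (\<integral>\<omega>. \<mu> $ i \<partial>M)"
    proof (rule integral_cong_AE)
      show "AE \<omega> in M. real_cond_exp M ?F (\<lambda>\<omega>. X t \<omega> $ i) \<omega> = \<mu> $ i"
        using mean by eventually_elim (auto simp: vec_cond_exp_def)
    qed auto
    finally show ?thesis by (simp add: prob_space)
  qed
  have "(\<integral>\<omega>. X t \<omega> \<partial>M) = \<mu>"
    unfolding vec_eq_iff
    using integral_bounded_linear[OF bounded_linear_vec_nth int] coord by simp
  then have mean0: "(\<integral>\<omega>. v \<bullet> (X t \<omega> - \<mu>) \<partial>M) = 0"
    using int by (simp add: prob_space)
  have int_v: "integrable M (\<lambda>\<omega>. v \<bullet> (X t \<omega> - \<mu>))"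
    using int by simp
  have "(\<integral>\<^sup>+\<omega>. ennreal (exp (z \<omega>)) \<partial>M) = (\<integral>\<^sup>+\<omega>. 1 * ennreal (exp (z \<omega>)) \<partial>M)"
    by simp
  also have "\<dots> = (\<integral>\<^sup>+\<omega>. 1 * nn_cond_exp M ?F (\<lambda>\<omega>. ennreal (exp (z \<omega>))) \<omega> \<partial>M)"
    by (rule S.nn_cond_exp_intg[symmetric]) auto
  also have "\<dots> \<le> (\<integral>\<^sup>+\<omega>. 1 \<partial>M)"
  proof (rule nn_integral_mono_AE)
    have "v \<in> sphere 0 1"
      using v by simp
    then have "AE \<omega> in M. nn_cond_exp M ?F (\<lambda>\<omega>. ennreal (exp (z \<omega>))) \<omega> \<le> 1"
      using sub t l(1,2) unfolding sub_psi_def z_def by blast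
    then show "AE \<omega> in M. 1 * nn_cond_exp M ?F (\<lambda>\<omega>. ennreal (exp (z \<omega>))) \<omega> \<le> 1"
      by simp
  qed
  also have "\<dots> = 1"
    by (simp add: emeasure_space_1)
  finally have le1: "(\<integral>\<^sup>+\<omega>. ennreal (exp (z \<omega>)) \<partial>M) \<le> 1" .
  have int_exp: "integrable M (\<lambda>\<omega>. exp (z \<omega>))"
    using le1 by (intro integrableI_nonneg) (auto simp: less_top[symmetric] top_unique)
  have "ennreal (\<integral>\<omega>. exp (z \<omega>) \<partial>M) \<le> 1"
    using le1 nn_integral_eq_integral[OF int_exp] by simp
  then have exp_le: "(\<integral>\<omega>. exp (z \<omega>) \<partial>M) \<le> 1"
    by simp
  \<comment> \<open>Only the centred linear term is subtracted, because its integrability is known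
    while that of the quadratic form is not. The remainder dominates the nonnegative part and has
    integral at most 0.\<close>
  define r where "r \<omega> = exp (z \<omega>) - 1 - l * (v \<bullet> (X t \<omega> - \<mu>))" for \<omega>
  have int_r: "integrable M r"
    unfolding r_def using int_exp int_v by simp
  have r_ge: "- \<psi> l * (v \<bullet> (\<Sigma> t \<omega> *v v)) \<le> r \<omega>" for \<omega>
    using exp_ge_add_one_self[of "z \<omega>"] unfolding r_def z_def by linarith
  have r_nonneg: "0 \<le> r \<omega>" if "\<omega> \<in> space M" for \<omega>
    using r_ge[of \<omega>] mult_nonneg_nonneg[of "- \<psi> l" "v \<bullet> (\<Sigma> t \<omega> *v v)"] q0[OF that] l(3) by linarith
  have "(\<integral>\<omega>. r \<omega> \<partial>M) \<le> 0"
    unfolding r_def using int_exp int_v exp_le mean0 by (simp add: prob_space)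
  then have "(\<integral>\<omega>. r \<omega> \<partial>M) = 0"
    using r_nonneg by (intro antisym integral_nonneg_AE) auto
  then have "AE \<omega> in M. r \<omega> = 0"
    using integral_nonneg_eq_0_iff_AE[OF int_r] r_nonneg by auto
  then show ?thesis
    using AE_space
  proof eventually_elim
    case (elim \<omega>)
    then have "- \<psi> l * (v \<bullet> (\<Sigma> t \<omega> *v v)) \<le> 0"
      using r_ge[of \<omega>] by simp
    then show ?case
      using l(3) q0[OF elim(2)] by (auto simp: mult_le_0_iff zero_le_mult_iff)
  qed
qed

text \<open>Polarisation: finitely many test vectors determine a symmetric matrix. This allows null
  sets that depend on the vector to be united.\<close>

lemma symmetric_matrix_eq_0:
  fixes A :: "real^'n^'n"
  assumes sym: "transpose A = A"
    and diag: "\<And>i. axis i 1 \<bullet> (A *v axis i 1) = 0"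
    and off: "\<And>i j. (axis i 1 + axis j 1) \<bullet> (A *v (axis i 1 + axis j 1)) = 0"
  shows "A = 0"
proof -
  have entry: "axis i 1 \<bullet> (A *v axis j 1) = A $ i $ j" for i j
    by (simp add: inner_axis' matrix_vector_mul_component inner_axis)
  have "A $ i $ j = 0" for i j
  proof -
    have "A $ i $ i + A $ i $ j + A $ j $ i + A $ j $ j = 0"
      using off[of i j] by (simp add: matrix_vector_right_distrib inner_add_left inner_add_right entry)
    moreover have "A $ j $ i = A $ i $ j"
      using sym by (metis transpose_def vec_lambda_beta)
    ultimately show ?thesis
      using diag[of i] diag[of j] by (simp add: entry)
  qed
  then show ?thesis
    by (simp add: vec_eq_iff)
qed

lemma (in prob_space) AE_variance_proxy_eq_0:
  fixes X :: "nat \<Rightarrow> 'a \<Rightarrow> real^'n" and \<Sigma> :: "nat \<Rightarrow> 'a \<Rightarrow> real^'n^'n"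
  assumes X: "\<And>t. t \<ge> 1 \<Longrightarrow> X t \<in> borel_measurable M"
    and int: "integrable M (X t)"
    and mean: "AE \<omega> in M. vec_cond_exp M (natural_filtration M X (t - 1)) (X t) \<omega> = \<mu>"
    and sub: "sub_psi M lmax \<psi> \<mu> \<Sigma> X"
    and l: "0 \<le> l" "ereal l < lmax" "\<psi> l < 0"
    and t: "t \<ge> 1"
  shows "AE \<omega> in M. \<Sigma> t \<omega> = 0"
proof -
  have all: "AE \<omega> in M. v \<bullet> (\<Sigma> t \<omega> *v v) = 0" for v
  proof (cases "v = 0")
    case False
    \<comment> \<open>The sub-\<psi> condition concerns unit vectors; rescaling changes the form by
      a nonzero factor.\<close>
    then have "norm (v /\<^sub>R norm v) = 1"
      by simp
    from AE_quadratic_form_eq_0[OF X int mean sub l t this]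
    show ?thesis
      using False by (simp add: matrix_vector_mult_scaleR)
  qed simp
  have "AE \<omega> in M. \<forall>i j. (axis i 1 + axis j 1) \<bullet> (\<Sigma> t \<omega> *v (axis i 1 + axis j 1)) = 0"
    by (simp add: AE_all_countable all)
  moreover have "AE \<omega> in M. \<forall>i. axis i 1 \<bullet> (\<Sigma> t \<omega> *v axis i 1) = 0"
    by (simp add: AE_all_countable all)
  ultimately show ?thesis
    using AE_space
  proof eventually_elim
    case (elim \<omega>)
    have "transpose (\<Sigma> t \<omega>) = \<Sigma> t \<omega>"
      using sub t elim(3) by (simp add: sub_psi_def pos_semidef_def)
    with elim(1,2) show ?case
      by (intro symmetric_matrix_eq_0) auto
  qed
qed

section \<open>Both cases for the sign of \<psi>, and the final constants\<close>

theorem theoremA3: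
  fixes M :: "'a measure"
    and X :: "nat \<Rightarrow> 'a \<Rightarrow> real^'n"
    and \<Sigma> :: "nat \<Rightarrow> 'a \<Rightarrow> real^'n^'n"
    and \<mu> :: "real^'n"
    and lmax :: ereal
    and \<psi> :: "real \<Rightarrow> real"
    and lam :: "nat \<Rightarrow> 'a \<Rightarrow> real"
    and \<alpha> :: real
  assumes "prob_space M"
    and "CARD('n) \<ge> 2"
    and "0 < lmax"
    and "\<And>t. t \<ge> 1 \<Longrightarrow> X t \<in> borel_measurable M"
    and "\<And>t. t \<ge> 1 \<Longrightarrow> integrable M (X t)"
    and "\<And>t. t \<ge> 1 \<Longrightarrow>
           AE \<omega> in M. vec_cond_exp M (natural_filtration M X (t - 1)) (X t) \<omega> = \<mu>"
    and "sub_psi M lmax \<psi> \<mu> \<Sigma> X"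
    and "predictable M X lam"
    and "\<And>t \<omega>. t \<ge> 1 \<Longrightarrow> \<omega> \<in> space M \<Longrightarrow> 0 \<le> lam t \<omega> \<and> ereal (lam t \<omega>) < lmax"
    and "0 < \<alpha>" "\<alpha> < 1"
  shows "\<exists>E\<in>sets M. measure M E \<ge> 1 - \<alpha> \<and>
    (\<forall>\<omega>\<in>E. \<forall>t\<ge>1. (\<Sum>i=1..t. lam i \<omega>) > 0 \<longrightarrow>
       norm ((\<Sum>i=1..t. lam i \<omega> *\<^sub>R X i \<omega>) /\<^sub>R (\<Sum>i=1..t. lam i \<omega>) - \<mu>)
       \<le> (sqrt (real CARD('n)) * (\<Sum>i=1..t. \<psi> (lam i \<omega>) * onorm ((*v) (\<Sigma> i \<omega>)))
            + 2 * sqrt (real CARD('n)) + sqrt (real CARD('n)) * ln (1 / \<alpha>))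
         / (2 / 3 * (\<Sum>i=1..t. lam i \<omega>)))"
proof -
  interpret prob_space M by fact
  let ?d = "real CARD('n)"
  note X = assms(4)
  have subalg: "subalgebra M (natural_filtration M X s)" for s
    by (rule subalgebra_natural_filtration[OF X])
  \<comment> \<open>The nonnegativity of the variance sum is carried along, since the final
    constants multiply this sum by 3/2.\<close>
  have "\<exists>E\<in>sets M. prob E \<ge> 1 - \<alpha> \<and> (\<forall>\<omega>\<in>E. \<forall>t.
      0 \<le> (\<Sum>i=1..t. \<psi> (lam i \<omega>) * onorm ((*v) (\<Sigma> i \<omega>))) \<and>
      norm (\<Sum>i=1..t. lam i \<omega> *\<^sub>R (X i \<omega> - \<mu>))
      \<le> sqrt ?d * ((\<Sum>i=1..t. \<psi> (lam i \<omega>) * onorm ((*v) (\<Sigma> i \<omega>))) + ln 2 + ln (1 / \<alpha>)))"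
  proof (cases "\<forall>l\<ge>0. ereal l < lmax \<longrightarrow> 0 \<le> \<psi> l")
    case True
    then obtain E where E: "E \<in> sets M" "prob E \<ge> 1 - \<alpha>"
      and bound: "\<And>\<omega> t. \<omega> \<in> E \<Longrightarrow> norm (\<Sum>i=1..t. lam i \<omega> *\<^sub>R (X i \<omega> - \<mu>))
        \<le> sqrt ?d * ((\<Sum>i=1..t. \<psi> (lam i \<omega>) * onorm ((*v) (\<Sigma> i \<omega>))) + ln 2 + ln (1 / \<alpha>))"
      using norm_sum_le_of_predictable[OF X assms(7,3) _ assms(8-10)] by blast
    moreover have "0 \<le> (\<Sum>i=1..t. \<psi> (lam i \<omega>) * onorm ((*v) (\<Sigma> i \<omega>)))" if "\<omega> \<in> E" for \<omega> t
    proof -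
      have "\<omega> \<in> space M"
        using that sets.sets_into_space[OF E(1)] by blast
      then show ?thesis
        using True assms(9)
        by (intro sum_nonneg mult_nonneg_nonneg onorm_pos_le matrix_vector_mul_bounded_linear) auto
    qed
    ultimately show ?thesis by blast
  next
    case False
    then obtain l where l: "0 \<le> l" "ereal l < lmax" "\<psi> l < 0"
      by (auto simp: not_le)
    have ae: "AE \<omega> in M. \<Sigma> t \<omega> = 0" if "t \<ge> 1" for t
      using AE_variance_proxy_eq_0[OF X assms(5)[OF that] assms(6)[OF that] assms(7) l that] .
    have \<Sigma>_meas: "\<Sigma> t \<in> borel_measurable M" if "t \<ge> 1" for t
      using assms(7) that unfolding sub_psi_def
      by (blast intro: measurable_from_subalg[OF subalg])
    \<comment> \<open>With \<open>\<Sigma> t = 0\<close> almost surely, replacing \<psi> by 0 alters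
      the exponent on a null set only.\<close>
    have "sub_psi M lmax (\<lambda>_. 0) \<mu> \<Sigma> X"
      unfolding sub_psi_def
    proof (intro allI ballI impI conjI)
      fix t :: nat and v :: "real^'n" and k :: real
      assume t: "1 \<le> t" and v: "v \<in> sphere 0 1" and k: "0 \<le> k" "ereal k < lmax"
      interpret S: sigma_finite_subalgebra M "natural_filtration M X (t - 1)"
        by (rule sigma_finite_subalgebraI[OF subalg])
      note [measurable] = X[OF t] \<Sigma>_meas[OF t]
      have "AE \<omega> in M. nn_cond_exp M (natural_filtration M X (t - 1))
            (\<lambda>\<omega>. ennreal (exp (k * (v \<bullet> (X t \<omega> - \<mu>)) - 0 * (v \<bullet> (\<Sigma> t \<omega> *v v))))) \<omega>
          = nn_cond_exp M (natural_filtration M X (t - 1))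
            (\<lambda>\<omega>. ennreal (exp (k * (v \<bullet> (X t \<omega> - \<mu>)) - \<psi> k * (v \<bullet> (\<Sigma> t \<omega> *v v))))) \<omega>"
      proof (rule S.nn_cond_exp_cong)
        show "AE \<omega> in M. ennreal (exp (k * (v \<bullet> (X t \<omega> - \<mu>)) - 0 * (v \<bullet> (\<Sigma> t \<omega> *v v))))
            = ennreal (exp (k * (v \<bullet> (X t \<omega> - \<mu>)) - \<psi> k * (v \<bullet> (\<Sigma> t \<omega> *v v))))"
          using ae[OF t] by eventually_elim simp
      qed measurable
      moreover have "AE \<omega> in M. nn_cond_exp M (natural_filtration M X (t - 1))
          (\<lambda>\<omega>. ennreal (exp (k * (v \<bullet> (X t \<omega> - \<mu>)) - \<psi> k * (v \<bullet> (\<Sigma> t \<omega> *v v))))) \<omega> \<le> 1"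
        using assms(7) t v k unfolding sub_psi_def by blast
      ultimately show "AE \<omega> in M. nn_cond_exp M (natural_filtration M X (t - 1))
          (\<lambda>\<omega>. ennreal (exp (k * (v \<bullet> (X t \<omega> - \<mu>)) - 0 * (v \<bullet> (\<Sigma> t \<omega> *v v))))) \<omega> \<le> 1"
        by eventually_elim simp
    qed (use assms(7) in \<open>auto simp: sub_psi_def\<close>)
    from norm_sum_le_of_predictable[OF X this assms(3) _ assms(8-10)]
    obtain E where E[measurable]: "E \<in> sets M" and prob: "prob E \<ge> 1 - \<alpha>"
      and bound: "\<And>\<omega> t. \<omega> \<in> E \<Longrightarrow> norm (\<Sum>i=1..t. lam i \<omega> *\<^sub>R (X i \<omega> - \<mu>))
        \<le> sqrt ?d * ((\<Sum>i=1..t. 0 * onorm ((*v) (\<Sigma> i \<omega>))) + ln 2 + ln (1 / \<alpha>))"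
      by blast
    \<comment> \<open>Removing one null set for all times makes the variance sum of the original
      \<psi> exactly 0, so the bound obtained for the zero function is the required one.\<close>
    have "AE \<omega> in M. \<forall>t\<in>{1..}. \<Sigma> t \<omega> = 0"
      by (subst AE_ball_countable) (auto intro: ae)
    then obtain N where N: "N \<in> null_sets M" "{\<omega>\<in>space M. \<not> (\<forall>t\<in>{1..}. \<Sigma> t \<omega> = 0)} \<subseteq> N"
      by (auto elim!: AE_E simp: null_sets_def)
    have "prob (E - N) = prob E"
      by (rule measure_Diff_null_set[OF E N(1)])
    moreover have "E - N \<in> sets M"
      using N(1) by auto
    moreover have "0 \<le> (\<Sum>i=1..t. \<psi> (lam i \<omega>) * onorm ((*v) (\<Sigma> i \<omega>))) \<and>
      norm (\<Sum>i=1..t. lam i \<omega> *\<^sub>R (X i \<omega> - \<mu>))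
      \<le> sqrt ?d * ((\<Sum>i=1..t. \<psi> (lam i \<omega>) * onorm ((*v) (\<Sigma> i \<omega>))) + ln 2 + ln (1 / \<alpha>))"
      if \<omega>: "\<omega> \<in> E - N" for \<omega> t
    proof -
      have "\<Sigma> i \<omega> = 0" if "i \<in> {1..t}" for i
        using \<omega> N(2) sets.sets_into_space[OF E] that by auto
      moreover have "(*v) (0 :: real^'n^'n) = (\<lambda>_. 0)"
        by (rule ext) simp
      ultimately have "(\<Sum>i=1..t. \<psi> (lam i \<omega>) * onorm ((*v) (\<Sigma> i \<omega>))) = 0"
        by (intro sum.neutral) (simp add: onorm_zero)
      then show ?thesis
        using bound[of \<omega> t] \<omega> by simp
    qed
    ultimately show ?thesis
      using prob by (intro bexI[of _ "E - N"] conjI ballI allI) auto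
  qed
  then obtain E where E: "E \<in> sets M" "prob E \<ge> 1 - \<alpha>"
    and V: "\<And>\<omega> t. \<omega> \<in> E \<Longrightarrow> 0 \<le> (\<Sum>i=1..t. \<psi> (lam i \<omega>) * onorm ((*v) (\<Sigma> i \<omega>)))"
    and bound: "\<And>\<omega> t. \<omega> \<in> E \<Longrightarrow> norm (\<Sum>i=1..t. lam i \<omega> *\<^sub>R (X i \<omega> - \<mu>))
      \<le> sqrt ?d * ((\<Sum>i=1..t. \<psi> (lam i \<omega>) * onorm ((*v) (\<Sigma> i \<omega>))) + ln 2 + ln (1 / \<alpha>))"
    by blast
  have "norm ((\<Sum>i=1..t. lam i \<omega> *\<^sub>R X i \<omega>) /\<^sub>R (\<Sum>i=1..t. lam i \<omega>) - \<mu>)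
      \<le> (sqrt ?d * (\<Sum>i=1..t. \<psi> (lam i \<omega>) * onorm ((*v) (\<Sigma> i \<omega>)))
            + 2 * sqrt ?d + sqrt ?d * ln (1 / \<alpha>)) / (2 / 3 * (\<Sum>i=1..t. lam i \<omega>))"
    if \<omega>: "\<omega> \<in> E" and pos: "(\<Sum>i=1..t. lam i \<omega>) > 0" for \<omega> t
  proof -
    define L where "L = (\<Sum>i=1..t. lam i \<omega>)"
    define V' where "V' = (\<Sum>i=1..t. \<psi> (lam i \<omega>) * onorm ((*v) (\<Sigma> i \<omega>)))"
    define S where "S = (\<Sum>i=1..t. lam i \<omega> *\<^sub>R (X i \<omega> - \<mu>))"
    have L: "0 < L"
      using pos by (simp add: L_def)
    have "S = (\<Sum>i=1..t. lam i \<omega> *\<^sub>R X i \<omega>) - L *\<^sub>R \<mu>"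
      by (simp add: S_def L_def scaleR_right_diff_distrib sum_subtractf scaleR_left.sum)
    then have "(\<Sum>i=1..t. lam i \<omega> *\<^sub>R X i \<omega>) /\<^sub>R L - \<mu> = S /\<^sub>R L"
      using L by (simp add: scaleR_right_diff_distrib)
    then have "norm ((\<Sum>i=1..t. lam i \<omega> *\<^sub>R X i \<omega>) /\<^sub>R L - \<mu>) = norm S / L"
      using L by (simp add: divide_inverse mult.commute)
    also have "\<dots> \<le> sqrt ?d * (3 / 2 * (V' + 2 + ln (1 / \<alpha>))) / L"
    proof (rule divide_right_mono)
      have "0 \<le> ln (1 / \<alpha>)"
        using assms(10,11) by simp
      \<comment> \<open>The constants are generous: \<open>V'\<close> and
        \<open>ln (1 / \<alpha>)\<close> are nonnegative and \<open>ln 2 < 1\<close>. The factor 3/2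
        is the reciprocal of the 2/3 in the stated denominator.\<close>
      then have "V' + ln 2 + ln (1 / \<alpha>) \<le> 3 / 2 * (V' + 2 + ln (1 / \<alpha>))"
        using V[OF \<omega>, of t] ln_2_less_1 by (simp add: V'_def)
      then have "sqrt ?d * (V' + ln 2 + ln (1 / \<alpha>)) \<le> sqrt ?d * (3 / 2 * (V' + 2 + ln (1 / \<alpha>)))"
        by (rule mult_left_mono) simp
      with bound[OF \<omega>, of t] show "norm S \<le> sqrt ?d * (3 / 2 * (V' + 2 + ln (1 / \<alpha>)))"
        unfolding S_def V'_def by (rule order_trans)
    qed (use L in simp)
    also have "\<dots> = (sqrt ?d * V' + 2 * sqrt ?d + sqrt ?d * ln (1 / \<alpha>)) / (2 / 3 * L)"
      using L by (simp add: field_simps)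
    finally show ?thesis
      by (simp only: L_def V'_def)
  qed
  with E show ?thesis by blast
qed

end
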